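(* Let $q>0$, $\alpha\in[0,1]$ and let $n\ge2$ be an integer. For $0\le k\le n$, the monic eigenvector $p_{k,q}^{(\alpha,n)}(x)$ of $T_{n,q,\alpha}$ associated with $\lambda_{k,q}^{(\alpha,n)}$ is a polynomial of degree $k$ given by $$p_{k,q}^{(\alpha,n)}(x)=\sum_{j=0}^k c_{n,q}(j,k)\,x^j,$$ where $p_{0,q}^{(\alpha,n)}(x)=1$, $p_{1,q}^{(\alpha,n)}(x)=x$, and, for $k=2,3,\ldots,n$, $c_{n,q}(k,k)=1$ and $$c_{n,q}(k-j,k)=\frac{1}{\lambda_{k,q}^{(\alpha,n)}-\lambda_{k-j,q}^{(\alpha,n)}}\sum_{i=0}^{j-1}c_{n,q}(k-i,k)\,a_{n,q}(k-j,k-i),\qquad j=1,2,\ldots,k.$$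
   Context: For $q>0$: $[0]_q=0$, $[m]_q=1+q+\cdots+q^{m-1}$ for $m\ge1$; $[0]_q!=1$, $[m]_q!=[1]_q[2]_q\cdots[m]_q$. The $q$-binomial coefficient is $\left[{m\atop k}\right]_q=\frac{[m]_q!}{[k]_q!\,[m-k]_q!}$ for $0\le k\le m$, and it is $0$ for $k<0$ or $k>m$. Also $(x;q)_0=1$, $(x;q)_k=\prod_{s=0}^{k-1}(1-xq^s)$. For $n\ge2$, the $(\alpha,q)$-Bernstein operator $T_{n,q,\alpha}$ maps a function $f$ on $[0,1]$ to the polynomial $$T_{n,q,\alpha}(f;x)=\sum_{i=0}^n f\!\left(\frac{[i]_q}{[n]_q}\right)p_{n,q,i}^{(\alpha)}(x),$$ $$p_{n,q,i}^{(\alpha)}(x)=\left(\left[{n-2\atop i}\right]_q\frac{(1-\alpha)x}{1-q^{n-i-1}x}+\left[{n-2\atop i-2}\right]_q(1-\alpha)q^{n-i}+\left[{n\atop i}\right]_q\alpha x\right)x^{i-1}(x;q)_{n-i},$$ understood as a polynomial in $x$ after cancellation (terms with a zero $q$-binomial coefficient are omitted). The numbers $\lambda_{k,q}^{(\alpha,n)}$ are $\lambda_{0,q}^{(\alpha,n)}=\lambda_{1,q}^{(\alpha,n)}=1$ and, for $2\le k\le n$, $$\lambda_{k,q}^{(\alpha,n)}=\frac{q^{k(k-1)/2}[n-2]_q!}{[n-k]_q![n]_q^k}\Big((1-\alpha)[n-k]_q[n-1+k]_q+\alpha[n]_q[n-1]_q\Big).$$ The $q$-Stirling numbers of the second kind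 are $S_q(k,r)=\frac{1}{[r]_q!\,q^{r(r-1)/2}}\sum_{i=0}^r(-1)^iq^{i(i-1)/2}\left[{r\atop i}\right]_q[r-i]_q^k$ (with $0^0=1$); in particular $S_q(0,0)=1$, $S_q(k,0)=0$ for $k>0$, $S_q(k,r)=0$ for $k<r$. For $1\le k\le n$ and $0\le r\le k$, $a_{n,q}(r,k)$ denotes the coefficient of $x^r$ in $T_{n,q,\alpha}(t^k;x)=\sum_{r=0}^k a_{n,q}(r,k)x^r$, that is, $$a_{n,q}(r,k)=\frac{q^{r(r-1)/2}[n-2]_q!}{[n]_q^k[n-r]_q!}\Big\{(1-\alpha)[n-r]_q\big([n+r-1]_qS_q(k+1,r+1)-[r+1]_q[n-1]_qS_q(k,r+1)\big)+\alpha[n]_q[n-1]_qS_q(k,r)\Big\}.$$ *)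

theory Defs
  imports Complex_Main "HOL-Computational_Algebra.Polynomial"
begin

definition qint :: "real \<Rightarrow> nat \<Rightarrow> real" where
  "qint q m = (\<Sum>s<m. q ^ s)"

definition qfact :: "real \<Rightarrow> nat \<Rightarrow> real" where
  "qfact q m = (\<Prod>s=1..m. qint q s)"

text \<open>The lower index is an integer, so that \<open>qbinom q m (int i - 2)\<close> vanishes for \<open>i < 2\<close>.\<close>

definition qbinom :: "real \<Rightarrow> nat \<Rightarrow> int \<Rightarrow> real" where
  "qbinom q m k =
    (if 0 \<le> k \<and> k \<le> int m then qfact q m / (qfact q (nat k) * qfact q (m - nat k)) else 0)"

definition qpoch :: "'a::comm_ring_1 \<Rightarrow> 'a \<Rightarrow> nat \<Rightarrow> 'a" where
  "qpoch x q k = (\<Prod>s<k. 1 - x * q ^ s)"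

text \<open>
  The basis polynomials \<open>p_{n,q,i}\<close> after cancellation. The factor \<open>1 - q^(n-i-1) x\<close> is the last
  one of \<open>(x;q)_{n-i}\<close>, so the first summand becomes \<open>x^i (x;q)_{n-i-1}\<close>. In the second summand
  the power is \<open>x^(i-1)\<close>. Wherever one of the natural number subtractions \<open>n - i - 1\<close>, \<open>i - 1\<close>
  truncates, the \<open>q\<close>-binomial coefficient in front of it is zero.
\<close>

definition bern_basis :: "real \<Rightarrow> real \<Rightarrow> nat \<Rightarrow> nat \<Rightarrow> real poly" where
  "bern_basis q \<alpha> n i =
     smult (qbinom q (n - 2) (int i) * (1 - \<alpha>))
       (monom 1 i * qpoch [:0, 1:] [:q:] (n - i - 1))
   + smult (qbinom q (n - 2) (int i - 2) * (1 - \<alpha>) * q ^ (n - i))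
       (monom 1 (i - 1) * qpoch [:0, 1:] [:q:] (n - i))
   + smult (qbinom q n (int i) * \<alpha>)
       (monom 1 i * qpoch [:0, 1:] [:q:] (n - i))"

text \<open>Only the values of \<open>f\<close> at the nodes \<open>[i]_q / [n]_q\<close>, which lie in \<open>[0, 1]\<close>, are used.\<close>

definition bernstein :: "real \<Rightarrow> real \<Rightarrow> nat \<Rightarrow> (real \<Rightarrow> real) \<Rightarrow> real poly" where
  "bernstein q \<alpha> n f = (\<Sum>i\<le>n. smult (f (qint q i / qint q n)) (bern_basis q \<alpha> n i))"

text \<open>Eigenvectors of the operator acting on functions on \<open>[0, 1]\<close>.\<close>

definition bernstein_eigenvector ::
    "real \<Rightarrow> real \<Rightarrow> nat \<Rightarrow> real \<Rightarrow> (real \<Rightarrow> real) \<Rightarrow> bool" where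
  "bernstein_eigenvector q \<alpha> n l f \<longleftrightarrow>
     (\<exists>x\<in>{0..1}. f x \<noteq> 0) \<and> (\<forall>x\<in>{0..1}. poly (bernstein q \<alpha> n f) x = l * f x)"

definition eigval :: "real \<Rightarrow> real \<Rightarrow> nat \<Rightarrow> nat \<Rightarrow> real" where
  "eigval q \<alpha> n k =
    (if k \<le> 1 then 1
     else q ^ (k * (k - 1) div 2) * qfact q (n - 2) / (qfact q (n - k) * qint q n ^ k)
          * ((1 - \<alpha>) * qint q (n - k) * qint q (n - 1 + k) + \<alpha> * qint q n * qint q (n - 1)))"

definition qstirling :: "real \<Rightarrow> nat \<Rightarrow> nat \<Rightarrow> real" where
  "qstirling q k r =
     1 / (qfact q r * q ^ (r * (r - 1) div 2))
     * (\<Sum>i\<le>r. (- 1) ^ i * q ^ (i * (i - 1) div 2) * qbinom q r (int i) * qint q (r - i) ^ k)"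

text \<open>
  The coefficient of \<open>x^r\<close> in the image of \<open>t^k\<close>, for \<open>1 \<le> k \<le> n\<close> and \<open>r \<le> k\<close>. In this range
  \<open>n + r - 1\<close> and \<open>n - r\<close> do not truncate.
\<close>

definition acoef :: "real \<Rightarrow> real \<Rightarrow> nat \<Rightarrow> nat \<Rightarrow> nat \<Rightarrow> real" where
  "acoef q \<alpha> n r k =
     q ^ (r * (r - 1) div 2) * qfact q (n - 2) / (qint q n ^ k * qfact q (n - r))
     * ((1 - \<alpha>) * qint q (n - r)
          * (qint q (n + r - 1) * qstirling q (k + 1) (r + 1)
             - qint q (r + 1) * qint q (n - 1) * qstirling q k (r + 1))
        + \<alpha> * qint q n * qint q (n - 1) * qstirling q k r)"

text \<open>
  The recursion for \<open>c(k - j, k)\<close>, written with \<open>r = k - j\<close>. The case \<open>k \<le> 1\<close> encodes the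
  conventions \<open>p_0 = 1\<close> and \<open>p_1 = x\<close>.
\<close>

function ccoef :: "real \<Rightarrow> real \<Rightarrow> nat \<Rightarrow> nat \<Rightarrow> nat \<Rightarrow> real" where
  "ccoef q \<alpha> n r k =
    (if r > k then 0
     else if r = k then 1
     else if k \<le> 1 then 0
     else 1 / (eigval q \<alpha> n k - eigval q \<alpha> n r)
          * (\<Sum>i<k - r. ccoef q \<alpha> n (k - i) k * acoef q \<alpha> n r (k - i)))"
  by auto
termination
  by (relation "measure (\<lambda>(q, \<alpha>, n, r, k). k - r)") auto

declare ccoef.simps [simp del]

definition eigpoly :: "real \<Rightarrow> real \<Rightarrow> nat \<Rightarrow> nat \<Rightarrow> real poly" where
  "eigpoly q \<alpha> n k = (\<Sum>j\<le>k. monom (ccoef q \<alpha> n j k) j)"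

end

theory Submission
  imports Defs
begin

text \<open>
  The operator maps \<open>t^k\<close>, for \<open>k \<le> n\<close>, to the polynomial \<open>\<Sum>r\<le>k. a(r, k) x^r\<close>
  (\<open>bernstein_power\<close>). On the space of polynomials of degree at most \<open>n\<close> it is therefore upper
  triangular with respect to the monomials, and its diagonal entries \<open>a(k, k)\<close> are the numbers
  \<open>\<lambda>\<^sub>k\<close>. They satisfy \<open>1 = \<lambda>\<^sub>0 = \<lambda>\<^sub>1 > \<lambda>\<^sub>2 > \<dots> > \<lambda>\<^sub>n\<close> (\<open>eigval_less\<close>). For \<open>k \<ge> 2\<close> the number
  \<open>\<lambda>\<^sub>k\<close> thus occurs once on the diagonal, so this space contains exactly one monic eigenvector for
  it. Its degree is \<open>k\<close>, and back substitution in the triangular system is the recursion for the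
  \<open>c(j, k)\<close>. The only coincidence, \<open>\<lambda>\<^sub>0 = \<lambda>\<^sub>1\<close>, does no harm because \<open>a(0, 1) = 0\<close>.

  The formula for the image of \<open>t^k\<close> is the main work. Let
  \<open>U\<^sub>m(f) = \<Sum>i\<le>m. [m, i]\<^sub>q f(i) x^i (x;q)\<^sub>m\<^sub>-\<^sub>i\<close> (\<open>qmoment\<close>), which is the \<open>q\<close>-Bernstein operator in
  degree \<open>m\<close> acting on functions of the index, and let \<open>E\<close> be the shift \<open>(E f)(i) = f(i + 1)\<close>. Then the
  part of the operator with weight \<open>1 - \<alpha>\<close> is \<open>U\<^sub>n\<^sub>-\<^sub>1(f) + U\<^sub>n\<^sub>-\<^sub>1(E f) - U\<^sub>n\<^sub>-\<^sub>2(E f)\<close>, and the part with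
  weight \<open>\<alpha>\<close> is \<open>U\<^sub>n(f)\<close> (\<open>poly_bernstein\<close>). The functional \<open>U\<^sub>m\<close> sends the falling factorial
  \<open>i \<mapsto> [i][i - 1]\<dots>[i - r + 1]\<close> to its value at \<open>m\<close> times \<open>x^r\<close> (\<open>qmoment_qfall\<close>). It remains
  to expand \<open>[i]^k\<close> and the shifted power \<open>[i + 1]^k\<close> in falling factorials of \<open>i\<close>. The coefficients
  are, up to powers of \<open>q\<close>, the Stirling numbers \<open>S(k, r)\<close> and \<open>S(k + 1, r + 1)\<close>, and this is how
  the latter enter the formula for \<open>a(r, k)\<close>.
\<close>

section \<open>\<open>q\<close>-integers and \<open>q\<close>-binomial coefficients\<close>

lemma qint_0 [simp]: "qint q 0 = 0"
  and qint_1 [simp]: "qint q (Suc 0) = 1"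
  by (simp_all add: qint_def)

lemma qint_add: "qint q (a + b) = qint q a + q ^ a * qint q b"
  by (induction b) (simp_all add: qint_def algebra_simps power_add)

lemma qint_split: "s \<le> i \<Longrightarrow> qint q i = qint q s + q ^ s * qint q (i - s)"
  using qint_add[of q s "i - s"] by simp

lemma qint_nonneg: "q > 0 \<Longrightarrow> 0 \<le> qint q m"
  by (simp add: qint_def sum_nonneg)

lemma qint_pos: "q > 0 \<Longrightarrow> m > 0 \<Longrightarrow> 0 < qint q m"
  unfolding qint_def by (rule sum_pos) auto

lemma qfact_0 [simp]: "qfact q 0 = 1"
  by (simp add: qfact_def)

lemma qfact_Suc: "qfact q (Suc m) = qint q (Suc m) * qfact q m"
  by (simp add: qfact_def)

lemma qfact_pos: "q > 0 \<Longrightarrow> 0 < qfact q m"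
  by (induction m) (simp_all add: qfact_Suc qint_pos)

lemma qbinom_eq_0: "m < i \<Longrightarrow> qbinom q m (int i) = 0"
  by (simp add: qbinom_def)

lemma qbinom_0: "q > 0 \<Longrightarrow> qbinom q m (int 0) = 1"
  using qfact_pos[of q m] by (simp add: qbinom_def)

lemma qbinom_eq: "i \<le> m \<Longrightarrow> qbinom q m (int i) = qfact q m / (qfact q i * qfact q (m - i))"
  by (simp add: qbinom_def)

lemma qbinom_Suc_Suc:
  assumes "q > 0" "i \<le> m"
  shows "qbinom q (Suc m) (int (Suc i)) = qbinom q m (int (Suc i)) + q ^ (m - i) * qbinom q m (int i)"
proof (cases "i = m")
  case True
  then show ?thesis
    using qfact_pos[OF assms(1), of m] qfact_pos[OF assms(1), of "Suc m"]
    by (simp add: qbinom_eq qbinom_eq_0 del: of_nat_Suc)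
next
  case False
  with assms(2) obtain d where m: "m = Suc (i + d)"
    using less_imp_Suc_add[of i m] by auto
  define A B where "A = qint q (Suc d)" and "B = qint q (Suc i)"
  have pos: "A > 0" "B > 0" "qfact q i > 0" "qfact q d > 0"
    using qint_pos qfact_pos assms(1) by (auto simp: A_def B_def)
  have "qint q (Suc m) = A + q ^ Suc d * B"
    using qint_add[of q "Suc d" "Suc i"] by (simp add: m A_def B_def add.commute)
  moreover have "Suc m - Suc i = Suc d" "m - Suc i = d" "m - i = Suc d" "Suc i \<le> m"
    using m by auto
  ultimately show ?thesis
    using pos
    by (simp add: qbinom_eq assms(2) qfact_Suc[of q m] qfact_Suc[of q i] qfact_Suc[of q d]
        del: of_nat_Suc power_Suc flip: A_def B_def)
      (simp add: field_simps del: power_Suc)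
qed

lemma qbinom_absorb:
  assumes "q > 0" "i \<le> m"
  shows "qbinom q (Suc m) (int (Suc i)) * qint q (Suc i) = qint q (Suc m) * qbinom q m (int i)"
  using assms qint_pos[OF assms(1), of "Suc i"] qfact_pos[OF assms(1), of i]
  by (simp add: qbinom_eq qfact_Suc field_simps del: of_nat_Suc)

lemma qbinom_absorb_compl:
  assumes "q > 0" "i \<le> m"
  shows "qbinom q (Suc m) (int i) * qint q (Suc m - i) = qint q (Suc m) * qbinom q m (int i)"
  using assms qint_pos[OF assms(1), of "Suc (m - i)"] qfact_pos[OF assms(1), of "m - i"]
  by (simp add: qbinom_eq qfact_Suc Suc_diff_le field_simps)

text \<open>
  Pascal's rule in summed form. Used with \<open>h\<close> the summand of \<open>qmoment\<close> it compares the moments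
  of orders \<open>m + 1\<close> and \<open>m\<close>; used with alternating signs it gives the recursion of the iterated
  \<open>q\<close>-difference behind the Stirling numbers.
\<close>

lemma sum_qbinom_Suc:
  assumes "q > 0"
  shows "(\<Sum>i\<le>Suc m. qbinom q (Suc m) (int i) * h i)
       = (\<Sum>i\<le>m. qbinom q m (int i) * (h i + q ^ (m - i) * h (Suc i)))"
proof -
  have "(\<Sum>i\<le>Suc m. qbinom q (Suc m) (int i) * h i)
      = h 0 + (\<Sum>i\<le>m. qbinom q (Suc m) (int (Suc i)) * h (Suc i))"
    unfolding sum.atMost_Suc_shift qbinom_0[OF assms] by simp
  also have "(\<Sum>i\<le>m. qbinom q (Suc m) (int (Suc i)) * h (Suc i))
      = (\<Sum>i\<le>m. qbinom q m (int (Suc i)) * h (Suc i))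
        + (\<Sum>i\<le>m. qbinom q m (int i) * (q ^ (m - i) * h (Suc i)))"
    unfolding sum.distrib[symmetric]
    by (intro sum.cong refl, subst qbinom_Suc_Suc) (use assms in \<open>auto simp: algebra_simps\<close>)
  also have "h 0 + (\<dots>) = (\<Sum>i\<le>Suc m. qbinom q m (int i) * h i)
        + (\<Sum>i\<le>m. qbinom q m (int i) * (q ^ (m - i) * h (Suc i)))"
    unfolding sum.atMost_Suc_shift qbinom_0[OF assms] by simp
  also have "\<dots> = (\<Sum>i\<le>m. qbinom q m (int i) * (h i + q ^ (m - i) * h (Suc i)))"
    by (simp add: qbinom_eq_0 sum.distrib distrib_left del: of_nat_Suc)
  finally show ?thesis .
qed

section \<open>\<open>q\<close>-Stirling numbers and falling factorials\<close>

lemma triangle_Suc: "Suc r * (Suc r - 1) div 2 = r * (r - 1) div 2 + r"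
proof (cases r)
  case (Suc s)
  have "Suc r * (Suc r - 1) = r * (r - 1) + 2 * r"
    by (simp add: Suc)
  then show ?thesis by simp
qed simp

text \<open>
  The value at \<open>0\<close> of the \<open>q\<close>-difference operator \<open>(E - q^(r-1)) \<dots> (E - q) (E - 1)\<close> applied to
  \<open>g\<close>, where \<open>E\<close> is the shift, expanded by the \<open>q\<close>-binomial theorem.
\<close>

definition qdiff :: "real \<Rightarrow> nat \<Rightarrow> (nat \<Rightarrow> real) \<Rightarrow> real" where
  "qdiff q r g = (\<Sum>i\<le>r. qbinom q r (int i) * ((- 1) ^ i * q ^ (i * (i - 1) div 2) * g (r - i)))"

lemma qdiff_Suc:
  assumes "q > 0"
  shows "qdiff q (Suc r) g = qdiff q r (\<lambda>i. g (Suc i)) - q ^ r * qdiff q r g"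
  unfolding qdiff_def sum_qbinom_Suc[OF assms] sum_distrib_left sum_subtractf[symmetric]
proof (intro sum.cong refl)
  fix i assume "i \<in> {..r}"
  then have i: "i \<le> r" by simp
  define u v where "u = q ^ (i * (i - 1) div 2)" and "v = q ^ (Suc i * (Suc i - 1) div 2)"
  have "q ^ (r - i) * v = q ^ r * u"
    unfolding u_def v_def power_add[symmetric] triangle_Suc using i by simp
  then have uv: "q ^ (r - i) * ((- 1) ^ Suc i * v * c) = - ((- 1) ^ i * (q ^ r * u) * c)" for c
    by (metis (no_types, lifting) mult.assoc mult.left_commute mult_minus1 mult_minus_left power_Suc)
  show "qbinom q r (int i) *
         ((- 1) ^ i * q ^ (i * (i - 1) div 2) * g (Suc r - i) +
          q ^ (r - i) * ((- 1) ^ Suc i * q ^ (Suc i * (Suc i - 1) div 2) * g (Suc r - Suc i))) =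
         qbinom q r (int i) * ((- 1) ^ i * q ^ (i * (i - 1) div 2) * g (Suc (r - i))) -
         q ^ r * (qbinom q r (int i) * ((- 1) ^ i * q ^ (i * (i - 1) div 2) * g (r - i)))"
    unfolding u_def[symmetric] v_def[symmetric] uv Suc_diff_le[OF i] diff_Suc_Suc
    by (simp add: algebra_simps)
qed

lemma qstirling_eq: "qstirling q k r = qdiff q r (\<lambda>i. qint q i ^ k) / (qfact q r * q ^ (r * (r - 1) div 2))"
  by (simp add: qstirling_def qdiff_def mult_ac)

text \<open>
  The factor \<open>[r + 1 - i]\<close> is absorbed into the \<open>q\<close>-binomial coefficient \<open>[r + 1, i]\<close>, which lowers
  the order of the difference by one.
\<close>

lemma qdiff_mult_qint:
  assumes "q > 0"
  shows "qdiff q (Suc r) (\<lambda>i. qint q i * g i) = qint q (Suc r) * qdiff q r (\<lambda>i. g (Suc i))"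
proof -
  have "qdiff q (Suc r) (\<lambda>i. qint q i * g i) = (\<Sum>i\<le>r. (qbinom q (Suc r) (int i) * qint q (Suc r - i))
      * ((- 1) ^ i * q ^ (i * (i - 1) div 2) * g (Suc r - i)))"
    unfolding qdiff_def by (simp add: mult_ac)
  also have "\<dots> = qint q (Suc r) * qdiff q r (\<lambda>i. g (Suc i))"
    unfolding qdiff_def sum_distrib_left
    by (intro sum.cong refl, subst qbinom_absorb_compl) (use assms in \<open>auto simp: Suc_diff_le mult.assoc\<close>)
  finally show ?thesis .
qed

text \<open>
  Let \<open>D g\<close> be the difference of order \<open>r\<close> of \<open>g(i) = [i]^k\<close>. After clearing denominators and
  dividing by \<open>[r + 1]\<close>, the left-hand side is \<open>D (E g)\<close> by absorption, and the two terms on the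
  right are \<open>q^r D g\<close> and, by \<open>qdiff_Suc\<close>, \<open>D (E g) - q^r D g\<close>.
\<close>

lemma qstirling_Suc_Suc:
  assumes "q > 0"
  shows "qstirling q (Suc k) (Suc r) = qstirling q k r + qint q (Suc r) * qstirling q k (Suc r)"
proof -
  define X where "X = q ^ (r * (r - 1) div 2)"
  define D where "D = qdiff q r (\<lambda>i. qint q i ^ k)"
  define D' where "D' = qdiff q r (\<lambda>i. qint q (Suc i) ^ k)"
  have nz: "X \<noteq> 0" "qint q (Suc r) \<noteq> 0" "qfact q r \<noteq> 0" "q ^ r \<noteq> 0"
    using assms qint_pos[OF assms, of "Suc r"] qfact_pos[OF assms, of r] by (auto simp: X_def)
  have e: "q ^ (Suc r * (Suc r - 1) div 2) = X * q ^ r"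
    unfolding triangle_Suc power_add X_def ..
  show ?thesis
    unfolding qstirling_eq e power_Suc qdiff_mult_qint[OF assms] qfact_Suc
    unfolding qdiff_Suc[OF assms] X_def[symmetric] D_def[symmetric] D'_def[symmetric]
    using nz assms by (auto simp: divide_simps algebra_simps)
qed

lemma qstirling_Suc_0 [simp]: "qstirling q (Suc k) 0 = 0"
  by (simp add: qstirling_def)

lemma qstirling_0_0 [simp]: "qstirling q 0 0 = 1"
  by (simp add: qstirling_def qbinom_def)

lemma qstirling_0_Suc: 
  assumes "q > 0"
  shows "qstirling q 0 (Suc r) = 0"
proof -
  have "qdiff q (Suc r) (\<lambda>_. 1) = 0"
    by (induction r) (simp_all add: qdiff_Suc[OF assms])
  then show ?thesis
    by (simp add: qstirling_eq)
qed

lemma qstirling_eq_0: "q > 0 \<Longrightarrow> k < r \<Longrightarrow> qstirling q k r = 0"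
proof (induction k arbitrary: r)
  case 0
  then show ?case by (cases r) (simp_all add: qstirling_0_Suc)
next
  case (Suc k)
  then show ?case by (cases r) (simp_all add: qstirling_Suc_Suc)
qed

lemma qstirling_self: "q > 0 \<Longrightarrow> qstirling q k k = 1"
  by (induction k) (simp_all add: qstirling_Suc_Suc qstirling_eq_0)

text \<open>
  The product \<open>[i][i - 1]\<dots>[i - r + 1]\<close>. Truncated subtraction is harmless: for \<open>i < r\<close> the product
  already contains the factor \<open>[0] = 0\<close>.
\<close>

definition qfall :: "real \<Rightarrow> nat \<Rightarrow> nat \<Rightarrow> real" where
  "qfall q r i = (\<Prod>s<r. qint q (i - s))"

lemma qfall_0 [simp]: "qfall q 0 i = 1"
  by (simp add: qfall_def)

lemma qfall_Suc: "qfall q (Suc r) i = qfall q r i * qint q (i - r)"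
  by (simp add: qfall_def)

lemma qfall_Suc_Suc: "qfall q (Suc r) (Suc i) = qint q (Suc i) * qfall q r i"
  unfolding qfall_def by (subst prod.lessThan_Suc_shift) simp

lemma qfall_eq_0: "i < r \<Longrightarrow> qfall q r i = 0"
  by (auto simp: qfall_def intro!: bexI[of _ i])

lemma qfall_mult_qfact: "r \<le> i \<Longrightarrow> qfall q r i * qfact q (i - r) = qfact q i"
proof (induction r)
  case (Suc r)
  then have "i - r = Suc (i - Suc r)" by simp
  with Suc show ?case by (simp add: qfall_Suc qfact_Suc mult.assoc)
qed simp

lemma qfall_mult_qint:
  "qfall q r i * qint q i = qint q r * qfall q r i + q ^ r * qfall q (Suc r) i"
proof (cases "i < r")
  case False
  then show ?thesis
    by (simp add: qfall_Suc qint_split[of r i] algebra_simps)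
qed (simp add: qfall_eq_0 qfall_Suc)

text \<open>
  Multiplication by \<open>[i] = [r] + q^r [i - r]\<close> sends a falling factorial of length \<open>r\<close> to a combination
  of those of lengths \<open>r\<close> and \<open>r + 1\<close>; on coefficients this is the recursion of the Stirling numbers.
\<close>

lemma qint_power_eq_sum_qfall:
  assumes "q > 0"
  shows "qint q i ^ k = (\<Sum>r\<le>k. qstirling q k r * q ^ (r * (r - 1) div 2) * qfall q r i)"
proof (induction k)
  case (Suc k)
  let ?t = "\<lambda>r. q ^ (r * (r - 1) div 2)"
  have t: "?t (Suc r) = ?t r * q ^ r" for r
    unfolding triangle_Suc power_add ..
  have "qint q i ^ Suc k = (\<Sum>r\<le>k. qstirling q k r * ?t r * (qfall q r i * qint q i))"
    using Suc.IH by (simp add: sum_distrib_left mult_ac)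
  also have "\<dots> = (\<Sum>r\<le>k. qint q r * (qstirling q k r * ?t r * qfall q r i))
      + (\<Sum>r\<le>k. qstirling q k r * ?t (Suc r) * qfall q (Suc r) i)"
    unfolding qfall_mult_qint sum.distrib[symmetric] t
    by (intro sum.cong refl) (simp only: algebra_simps)
  also have "(\<Sum>r\<le>k. qint q r * (qstirling q k r * ?t r * qfall q r i))
      = (\<Sum>r\<le>Suc k. qint q r * (qstirling q k r * ?t r * qfall q r i))"
    by (simp add: qstirling_eq_0 assms)
  also have "\<dots> = (\<Sum>r\<le>k. qint q (Suc r) * (qstirling q k (Suc r) * ?t (Suc r) * qfall q (Suc r) i))"
    by (simp only: sum.atMost_Suc_shift) simp
  also have "\<dots> + (\<Sum>r\<le>k. qstirling q k r * ?t (Suc r) * qfall q (Suc r) i)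
     = (\<Sum>r\<le>k. qstirling q (Suc k) (Suc r) * ?t (Suc r) * qfall q (Suc r) i)"
    unfolding qstirling_Suc_Suc[OF assms] sum.distrib[symmetric]
    by (intro sum.cong refl) (simp only: algebra_simps)
  also have "\<dots> = (\<Sum>r\<le>Suc k. qstirling q (Suc k) r * ?t r * qfall q r i)"
    by (simp only: sum.atMost_Suc_shift) simp
  finally show ?case .
qed simp

text \<open>
  Every falling factorial of \<open>i + 1\<close> of positive length is \<open>[i + 1]\<close> times one of \<open>i\<close>, so this is the
  expansion of \<open>[i + 1]^(k + 1)\<close> divided by \<open>[i + 1]\<close>.
\<close>

lemma qint_Suc_power_eq_sum_qfall:
  assumes "q > 0"
  shows "qint q (Suc i) ^ k
       = (\<Sum>r\<le>k. qstirling q (Suc k) (Suc r) * q ^ (r * (r - 1) div 2 + r) * qfall q r i)"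
proof -
  have "qint q (Suc i) * qint q (Suc i) ^ k
      = (\<Sum>r\<le>k. qstirling q (Suc k) (Suc r) * q ^ (Suc r * (Suc r - 1) div 2) * qfall q (Suc r) (Suc i))"
    using qint_power_eq_sum_qfall[OF assms, of "Suc i" "Suc k"]
    by (simp only: sum.atMost_Suc_shift power_Suc) simp
  also have "\<dots> = qint q (Suc i) *
      (\<Sum>r\<le>k. qstirling q (Suc k) (Suc r) * q ^ (r * (r - 1) div 2 + r) * qfall q r i)"
    unfolding triangle_Suc qfall_Suc_Suc sum_distrib_left by (intro sum.cong refl) (simp only: mult_ac)
  finally show ?thesis
    using qint_pos[OF assms, of "Suc i"] by simp
qed

section \<open>The operator on monomials\<close>

text \<open>
  The argument \<open>f\<close> is a function of the index and not of the node \<open>[i] / [n]\<close>. Sums of different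
  orders \<open>m\<close> can then be compared for the same \<open>f\<close>, and \<open>f\<close> can be shifted.
\<close>

definition qmoment :: "real \<Rightarrow> real \<Rightarrow> nat \<Rightarrow> (nat \<Rightarrow> real) \<Rightarrow> real" where
  "qmoment q x m f = (\<Sum>i\<le>m. qbinom q m (int i) * (f i * x ^ i * qpoch x q (m - i)))"

lemma qmoment_sum: "qmoment q x m (\<lambda>i. \<Sum>r\<in>A. c r * f r i) = (\<Sum>r\<in>A. c r * qmoment q x m (f r))"
  unfolding qmoment_def sum_distrib_left sum_distrib_right
  by (subst sum.swap) (simp add: mult_ac)

text \<open>
  The factor \<open>1 - x q^(m - i)\<close> by which \<open>(x;q)\<close> grows combines with the weight \<open>q^(m - i)\<close> of the
  shifted term in Pascal's rule, so that only the increment of \<open>f\<close> is left.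
\<close>

lemma qmoment_Suc:
  assumes "q > 0"
  shows "qmoment q x (Suc m) f = qmoment q x m f
    + x * (\<Sum>i\<le>m. qbinom q m (int i) * q ^ (m - i) * ((f (Suc i) - f i) * x ^ i * qpoch x q (m - i)))"
  unfolding qmoment_def sum_qbinom_Suc[OF assms] sum_distrib_left sum.distrib[symmetric]
proof (intro sum.cong refl)
  fix i assume "i \<in> {..m}"
  then have "qpoch x q (Suc m - i) = qpoch x q (m - i) * (1 - x * q ^ (m - i))"
    by (simp add: Suc_diff_le qpoch_def)
  then show "qbinom q m (int i) * (f i * x ^ i * qpoch x q (Suc m - i)
        + q ^ (m - i) * (f (Suc i) * x ^ Suc i * qpoch x q (Suc m - Suc i)))
      = qbinom q m (int i) * (f i * x ^ i * qpoch x q (m - i))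
        + x * (qbinom q m (int i) * q ^ (m - i) * ((f (Suc i) - f i) * x ^ i * qpoch x q (m - i)))"
    unfolding diff_Suc_Suc power_Suc by (simp only:) (simp add: algebra_simps)
qed

lemma qmoment_const: "q > 0 \<Longrightarrow> qmoment q x m (\<lambda>_. 1) = 1"
proof (induction m)
  case 0
  then show ?case by (simp add: qmoment_def qbinom_def qpoch_def)
qed (simp add: qmoment_Suc)

lemma qmoment_mult_qint:
  assumes "q > 0"
  shows "qmoment q x (Suc m) (\<lambda>i. qint q i * f (i - 1)) = qint q (Suc m) * x * qmoment q x m f"
proof -
  have "qmoment q x (Suc m) (\<lambda>i. qint q i * f (i - 1))
      = (\<Sum>i\<le>m. (qbinom q (Suc m) (int (Suc i)) * qint q (Suc i)) * (f i * x ^ Suc i * qpoch x q (m - i)))"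
    unfolding qmoment_def by (simp only: sum.atMost_Suc_shift) (simp add: mult_ac)
  also have "\<dots> = qint q (Suc m) * x * qmoment q x m f"
    unfolding qmoment_def sum_distrib_left
    by (intro sum.cong refl, subst qbinom_absorb) (use assms in \<open>auto simp: mult_ac\<close>)
  finally show ?thesis .
qed

lemma qmoment_qfall: "q > 0 \<Longrightarrow> qmoment q x m (qfall q r) = qfall q r m * x ^ r"
proof (induction r arbitrary: m)
  case 0
  then show ?case
    using qmoment_const[of q x m] by (simp add: qfall_def)
next
  case (Suc r)
  have *: "qfall q (Suc r) = (\<lambda>i. qint q i * qfall q r (i - 1))"
  proof
    fix i show "qfall q (Suc r) i = qint q i * qfall q r (i - 1)"
      by (cases i) (simp_all add: qfall_Suc_Suc qfall_eq_0)
  qed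
  show ?case
  proof (cases m)
    case 0
    then show ?thesis by (simp add: qmoment_def qfall_eq_0)
  next
    case (Suc l)
    have "qmoment q x m (qfall q (Suc r)) = qint q (Suc l) * x * (qfall q r l * x ^ r)"
      unfolding * Suc qmoment_mult_qint[OF Suc.prems] Suc.IH[OF Suc.prems] ..
    then show ?thesis
      by (simp add: Suc qfall_Suc_Suc)
  qed
qed

lemma poly_qpoch: "poly (qpoch [:0, 1:] [:q:] k) x = qpoch x q k"
  by (simp add: qpoch_def poly_prod poly_power)

text \<open>
  For \<open>n = m + 2\<close> the part with weight \<open>1 - \<alpha>\<close> is a sum over \<open>i \<le> m\<close> in which \<open>g(i)\<close> is replaced by
  \<open>g(i) + q^(m-i) x (g(i+2) - g(i))\<close>. The increment \<open>g(i+2) - g(i)\<close> is that of \<open>g + E g\<close> from \<open>i\<close> to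
  \<open>i + 1\<close>, so by \<open>qmoment_Suc\<close> the second part equals the difference of the moments of \<open>g + E g\<close> of
  orders \<open>m + 1\<close> and \<open>m\<close>; the moments of \<open>g\<close> of order \<open>m\<close> cancel.
\<close>

lemma poly_bernstein:
  fixes m :: nat
  assumes "q > 0"
  defines "g \<equiv> \<lambda>f i. f (qint q i / qint q (Suc (Suc m)))"
  shows "poly (bernstein q \<alpha> (Suc (Suc m)) f) x =
    (1 - \<alpha>) * (qmoment q x (Suc m) (g f) + qmoment q x (Suc m) (\<lambda>i. g f (Suc i))
               - qmoment q x m (\<lambda>i. g f (Suc i)))
    + \<alpha> * qmoment q x (Suc (Suc m)) (g f)"
proof -
  define G where "G = g f"
  define b where "b i = qbinom q m (int i)" for i
  define X where "X j = qpoch x q j" for j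
  have X: "X (Suc m - i) = X (m - i) * (1 - x * q ^ (m - i))" if "i \<le> m" for i
    using that by (simp add: Suc_diff_le X_def qpoch_def)
  have "poly (bernstein q \<alpha> (Suc (Suc m)) f) x =
      (1 - \<alpha>) * ((\<Sum>i\<le>Suc (Suc m). b i * (G i * x ^ i * X (Suc m - i)))
       + (\<Sum>i\<le>Suc (Suc m). qbinom q m (int i - 2) * (q ^ (Suc (Suc m) - i) * G i * x ^ (i - 1)
            * X (Suc (Suc m) - i))))
      + \<alpha> * qmoment q x (Suc (Suc m)) G"
    unfolding bernstein_def poly_sum bern_basis_def qmoment_def sum_distrib_left sum.distrib[symmetric]
    by (intro sum.cong refl)
      (simp add: poly_qpoch poly_monom G_def g_def b_def X_def algebra_simps del: of_nat_Suc sum.atMost_Suc)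
  also have "(\<Sum>i\<le>Suc (Suc m). b i * (G i * x ^ i * X (Suc m - i)))
      = (\<Sum>i\<le>m. b i * (G i * x ^ i * X (Suc m - i)))"
    by (simp add: b_def qbinom_eq_0 del: of_nat_Suc)
  also have "(\<Sum>i\<le>Suc (Suc m). qbinom q m (int i - 2) * (q ^ (Suc (Suc m) - i) * G i * x ^ (i - 1)
            * X (Suc (Suc m) - i)))
      = (\<Sum>i\<le>m. b i * (q ^ (m - i) * G (Suc (Suc i)) * x ^ Suc i * X (m - i)))"
    by (simp only: sum.atMost_Suc_shift) (simp add: b_def qbinom_def)
  also have "(\<Sum>i\<le>m. b i * (G i * x ^ i * X (Suc m - i)))
      + (\<Sum>i\<le>m. b i * (q ^ (m - i) * G (Suc (Suc i)) * x ^ Suc i * X (m - i)))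
      = qmoment q x (Suc m) G + qmoment q x (Suc m) (\<lambda>i. G (Suc i)) - qmoment q x m (\<lambda>i. G (Suc i))"
    unfolding qmoment_Suc[OF assms(1)]
    unfolding qmoment_def b_def[symmetric] X_def[symmetric] sum_distrib_left
      sum.distrib[symmetric] sum_subtractf[symmetric]
    by (intro sum.cong refl) (simp add: X algebra_simps)
  finally show ?thesis
    unfolding G_def .
qed

text \<open>
  The form in which the coefficient appears when the moments of \<open>poly_bernstein\<close> are evaluated on
  falling factorials. It differs from the definition by the recursion of the Stirling numbers and by
  writing quotients of factorials as falling factorials.
\<close>

lemma acoef_eq_qfall:
  assumes "q > 0" and r: "r \<le> Suc (Suc m)"
  shows "acoef q \<alpha> (Suc (Suc m)) r k = q ^ (r * (r - 1) div 2) / qint q (Suc (Suc m)) ^ k *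
     ((1 - \<alpha>) * (qstirling q k r * qfall q r (Suc m)
                + q ^ r * qstirling q (Suc k) (Suc r) * (qfall q r (Suc m) - qfall q r m))
      + \<alpha> * (qstirling q k r * qfall q r (Suc (Suc m))))"
proof -
  let ?n = "Suc (Suc m)"
  let ?S = "qstirling q (Suc k) (Suc r)"
  define Z where "Z = q ^ (r * (r - 1) div 2) / qint q ?n ^ k"
  have nz: "qfact q j \<noteq> 0" for j using qfact_pos[OF assms(1), of j] by simp
  have nz': "qint q (Suc j) \<noteq> 0" for j using qint_pos[OF assms(1), of "Suc j"] by simp
  have B: "qfact q m / qfact q (?n - r) * (qint q ?n * qint q (Suc m)) = qfall q r ?n"
    using qfall_mult_qfact[OF r, of q, symmetric] nz[of "?n - r"]
    by (simp add: qfact_Suc nonzero_divide_eq_eq mult_ac)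
  have A: "qfact q m / qfact q (?n - r) * qint q (?n - r) *
      (qint q (?n + r - 1) * ?S - qint q (r + 1) * qint q (?n - 1) * qstirling q k (Suc r))
     = qstirling q k r * qfall q r (Suc m) + q ^ r * ?S * (qfall q r (Suc m) - qfall q r m)"
  proof (cases r)
    case 0
    have "qstirling q k 0 = qstirling q (Suc k) (Suc 0) - qstirling q k (Suc 0)"
      using qstirling_Suc_Suc[OF assms(1), of k 0] by simp
    moreover have "qfact q m / qfact q ?n * qint q ?n * qint q (Suc m) = 1"
      using B[unfolded 0] by (simp only: mult.assoc minus_nat.diff_0 qfall_0)
    moreover have "?n + 0 - 1 = Suc m" "?n - 1 = Suc m" by simp_all
    ultimately show ?thesis
      unfolding 0 by (simp only: minus_nat.diff_0 qfall_0 qint_1 add_0 One_nat_def)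
        (simp add: nz nz' mult.assoc flip: right_diff_distrib)
  next
    case (Suc s)
    \<comment> \<open>At \<open>r = n\<close> both sides vanish; the quotient of factorials is not a falling factorial there.\<close>
    have F: "qfact q m / qfact q (?n - r) * qint q (?n - r) = qfall q s m"
    proof (cases "s \<le> m")
      case True
      then have "?n - r = Suc (m - s)" using Suc by simp
      then show ?thesis
        using qfall_mult_qfact[OF True, of q] nz[of "m - s"] qint_pos[OF assms(1), of "Suc (m - s)"]
        by (simp add: qfact_Suc field_simps)
    next
      case False
      then show ?thesis using Suc r by (simp add: qfall_eq_0)
    qed
    have e: "?n + r - 1 = Suc m + r" by simp
    have D: "q ^ r * qfall q s m * (qint q (Suc m) - qint q (m - s)) = qfall q s m * q ^ Suc m * qint q r"
    proof (cases "s \<le> m")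
      case True
      have "qint q (Suc m) - qint q (m - s) = q ^ (m - s) * qint q r"
        using qint_add[of q "m - s" r] True Suc by simp
      then have "q ^ r * qfall q s m * (qint q (Suc m) - qint q (m - s))
          = qfall q s m * (q ^ r * q ^ (m - s)) * qint q r"
        by (simp only: mult_ac)
      also have "q ^ r * q ^ (m - s) = q ^ Suc m"
        unfolding power_add[symmetric] using True Suc by simp
      finally show ?thesis .
    qed (simp add: qfall_eq_0)
    have "qfall q s m * (qint q (Suc m + r) * ?S - qint q (Suc r) * qint q (Suc m) * qstirling q k (Suc r))
       = qfall q s m * qint q (Suc m) * (?S - qint q (Suc r) * qstirling q k (Suc r))
        + qfall q s m * q ^ Suc m * qint q r * ?S"
      unfolding qint_add[of q "Suc m"] by (simp only: algebra_simps)
    also have "\<dots> = qfall q s m * qint q (Suc m) * qstirling q k r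
        + q ^ r * qfall q s m * (qint q (Suc m) - qint q (m - s)) * ?S"
      unfolding D by (simp add: qstirling_Suc_Suc[OF assms(1), of k r] del: power_Suc)
    also have "\<dots> = qstirling q k r * qfall q r (Suc m) + q ^ r * ?S * (qfall q r (Suc m) - qfall q r m)"
      unfolding Suc qfall_Suc_Suc qfall_Suc[of q s m] by (simp only: algebra_simps)
    finally show ?thesis unfolding F e by simp
  qed
  define R where "R = qfact q m / qfact q (?n - r)"
  have ZR: "q ^ (r * (r - 1) div 2) * qfact q m / (qint q ?n ^ k * qfact q (?n - r)) = Z * R"
    by (simp add: Z_def R_def)
  have n: "?n - 2 = m" "?n - 1 = Suc m" "k + 1 = Suc k" "r + 1 = Suc r"
    by simp_all
  have "acoef q \<alpha> ?n r k = Z * ((1 - \<alpha>) * (qfact q m / qfact q (?n - r) * qint q (?n - r) *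
      (qint q (?n + r - 1) * ?S - qint q (r + 1) * qint q (?n - 1) * qstirling q k (Suc r)))
      + \<alpha> * (qstirling q k r * (qfact q m / qfact q (?n - r) * (qint q ?n * qint q (Suc m)))))"
    unfolding acoef_def n ZR R_def[symmetric] by (simp only: algebra_simps)
  then show ?thesis
    unfolding A B Z_def .
qed

lemma bernstein_power:
  assumes "q > 0" "n \<ge> 2" "k \<le> n"
  shows "bernstein q \<alpha> n (\<lambda>t. t ^ k) = (\<Sum>r\<le>k. monom (acoef q \<alpha> n r k) r)"
proof -
  obtain m where n: "n = Suc (Suc m)"
    using assms(2) le_Suc_ex[of 2 n] by auto
  define N where "N = qint q (Suc (Suc m)) ^ k"
  let ?t = "\<lambda>r. q ^ (r * (r - 1) div 2)"
  have U: "qmoment q x l (\<lambda>i. (qint q i / qint q (Suc (Suc m))) ^ k)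
      = (\<Sum>r\<le>k. (qstirling q k r * ?t r / N) * (qfall q r l * x ^ r))" for x l
    unfolding power_divide N_def[symmetric]
    unfolding qint_power_eq_sum_qfall[OF assms(1), of _ k] sum_divide_distrib
    using qmoment_sum[of q x l "\<lambda>r. qstirling q k r * ?t r / N" "qfall q" "{..k}"]
    by (simp add: qmoment_qfall[OF assms(1)])
  have V: "qmoment q x l (\<lambda>i. (qint q (Suc i) / qint q (Suc (Suc m))) ^ k)
      = (\<Sum>r\<le>k. (qstirling q (Suc k) (Suc r) * (?t r * q ^ r) / N) * (qfall q r l * x ^ r))" for x l
    unfolding power_divide N_def[symmetric]
    unfolding qint_Suc_power_eq_sum_qfall[OF assms(1)] sum_divide_distrib power_add
    using qmoment_sum[of q x l "\<lambda>r. qstirling q (Suc k) (Suc r) * (?t r * q ^ r) / N" "qfall q" "{..k}"]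
    by (simp add: qmoment_qfall[OF assms(1)])
  have "poly (bernstein q \<alpha> n (\<lambda>t. t ^ k)) x = poly (\<Sum>r\<le>k. monom (acoef q \<alpha> n r k) r) x" for x
    unfolding n poly_bernstein[OF assms(1)] U V poly_sum poly_monom
      sum_distrib_left sum_subtractf[symmetric] sum.distrib[symmetric]
  proof (intro sum.cong refl)
    fix r assume "r \<in> {..k}"
    then have r: "r \<le> Suc (Suc m)" using assms(3) n by simp
    show "(1 - \<alpha>) * (qstirling q k r * ?t r / N * (qfall q r (Suc m) * x ^ r)
        + qstirling q (Suc k) (Suc r) * (?t r * q ^ r) / N * (qfall q r (Suc m) * x ^ r)
        - qstirling q (Suc k) (Suc r) * (?t r * q ^ r) / N * (qfall q r m * x ^ r))
        + \<alpha> * (qstirling q k r * ?t r / N * (qfall q r (Suc (Suc m)) * x ^ r))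
        = acoef q \<alpha> (Suc (Suc m)) r k * x ^ r"
      unfolding acoef_eq_qfall[OF assms(1) r] N_def[symmetric]
      by (simp add: divide_inverse) (simp add: algebra_simps)
  qed
  then show ?thesis
    by (simp add: poly_eq_poly_eq_iff[symmetric] fun_eq_iff)
qed

section \<open>The eigenvalues\<close>

text \<open>
  For \<open>k \<le> 1\<close> the diagonal entries are \<open>1\<close>, in agreement with the convention for \<open>\<lambda>\<^sub>0\<close> and \<open>\<lambda>\<^sub>1\<close>,
  because the operator reproduces \<open>1\<close> and \<open>t\<close>.
\<close>

lemma eigval_eq_acoef:
  assumes "q > 0" "n \<ge> 2" "k \<le> n"
  shows "eigval q \<alpha> n k = acoef q \<alpha> n k k"
proof (cases "k \<le> 1")
  case True
  obtain m where n: "n = Suc (Suc m)"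
    using assms(2) le_Suc_ex[of 2 n] by auto
  have N: "qint q (Suc m) + q * (qint q (Suc m) - qint q m) = qint q n"
    by (simp add: n qint_def)
  have S: "qstirling q 1 1 = 1" "qstirling q (Suc 1) (Suc 1) = 1"
    using assms(1) by (rule qstirling_self)+
  have F: "qfall q 1 j = qint q j" for j
    by (simp add: qfall_def)
  have "acoef q \<alpha> n 1 1 = 1 / qint q n * ((1 - \<alpha>) * qint q n + \<alpha> * qint q n)"
    using acoef_eq_qfall[OF assms(1), of 1 m \<alpha> 1, folded n] assms(2)
    unfolding S F mult_1 mult_1_right power_one_right N by simp
  also have "\<dots> = 1"
  proof -
    have "(1 - \<alpha>) * qint q n + \<alpha> * qint q n = qint q n"
      by (simp add: left_diff_distrib)
    then show ?thesis
      using qint_pos[OF assms(1), of n] assms(2) by simp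
  qed
  finally have "acoef q \<alpha> n 1 1 = 1" .
  moreover have "acoef q \<alpha> n 0 0 = 1"
    using acoef_eq_qfall[OF assms(1), of 0 m \<alpha> 0, folded n] by simp
  moreover have "k = 0 \<or> k = 1"
    using True by linarith
  ultimately have "acoef q \<alpha> n k k = 1"
    by auto
  then show ?thesis
    using True by (simp add: eigval_def)
next
  case False
  have e: "n + k - 1 = n - 1 + k"
    using assms(2) by simp
  have S: "qstirling q (k + 1) (k + 1) = 1" "qstirling q k k = 1" "qstirling q k (k + 1) = 0"
    using assms(1) by (simp_all add: qstirling_self qstirling_eq_0)
  show ?thesis
    unfolding eigval_def acoef_def e S if_not_P[OF False] by (simp add: mult.commute[of "qint q n ^ k"])
qed

text \<open>
  The product of two \<open>q\<close>-integers of fixed index sum decreases as the indices move apart. This makes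
  the bracket in \<open>\<lambda>\<^sub>k\<close> non-increasing in \<open>k\<close>.
\<close>

lemma qint_mult_diff:
  assumes "k < n"
  shows "qint q (n - k) * qint q (n - 1 + k) - qint q (n - Suc k) * qint q (n - 1 + Suc k)
       = q ^ (n - Suc k) * qint q (2 * k)"
proof -
  define d where "d = n - Suc k"
  have n: "n = Suc (k + d)" using assms by (simp add: d_def)
  have "qint q (Suc d) = qint q d + q ^ d"
    "qint q (Suc (2 * k + d)) = qint q (2 * k + d) + q ^ (2 * k) * q ^ d"
    by (simp_all add: qint_def power_add)
  moreover have "qint q (2 * k + d) = qint q (2 * k) + q ^ (2 * k) * qint q d"
    by (rule qint_add)
  moreover have "n - k = Suc d" "n - 1 + k = 2 * k + d" "n - Suc k = d" "n - 1 + Suc k = Suc (2 * k + d)"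
    by (simp_all add: n)
  ultimately show ?thesis
    by (simp only:) (simp add: algebra_simps)
qed

text \<open>
  Write \<open>\<lambda>\<^sub>k = Z\<^sub>k M\<^sub>k\<close> with \<open>M\<^sub>k\<close> the bracket. Then \<open>Z\<^sub>k\<^sub>+\<^sub>1 = \<rho> Z\<^sub>k\<close> with
  \<open>\<rho> = q^k [n - k] / [n] = ([n] - [k]) / [n] < 1\<close>, and \<open>M\<^sub>k\<^sub>+\<^sub>1 \<le> M\<^sub>k\<close>. The inequality is
  strict because \<open>M\<^sub>k > 0\<close> for \<open>k < n\<close>; for \<open>\<alpha> = 0\<close> the last eigenvalue is \<open>0\<close>.
\<close>

lemma eigval_Suc_less:
  assumes "q > 0" "0 \<le> \<alpha>" "\<alpha> \<le> 1" "n \<ge> 2" and k: "1 \<le> k" "k < n"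
  shows "eigval q \<alpha> n (Suc k) < eigval q \<alpha> n k"
proof -
  define Z where "Z = q ^ (k * (k - 1) div 2) * qfact q (n - 2) / (qint q n ^ k * qfact q (n - k))"
  define M where "M j = (1 - \<alpha>) * (qint q (n - j) * qint q (n - 1 + j)) + \<alpha> * qint q n * qint q (n - 1)" for j
  define \<rho> where "\<rho> = q ^ k * qint q (n - k) / qint q n"
  note pos = qint_pos[OF assms(1)] and nn = qint_nonneg[OF assms(1)]
  have n0: "qint q n > 0" using assms pos by simp
  have acoef: "acoef q \<alpha> n j j = q ^ (j * (j - 1) div 2) * qfact q (n - 2) / (qint q n ^ j * qfact q (n - j)) * M j" for j
  proof -
    have "n + j - 1 = n - 1 + j" using assms by simp
    then show ?thesis
      by (simp add: acoef_def M_def qstirling_self[OF assms(1)] qstirling_eq_0[OF assms(1)])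
  qed
  have Z: "Z > 0" using assms n0 qfact_pos[OF assms(1)] by (simp add: Z_def)
  have "qint q n = qint q k + q ^ k * qint q (n - k)"
    using k by (intro qint_split) simp
  then have \<rho>: "0 \<le> \<rho>" "\<rho> < 1"
    using n0 nn[of "n - k"] pos[of k] k assms(1) by (simp_all add: \<rho>_def)
  have "M k - M (Suc k) = (1 - \<alpha>) * (q ^ (n - Suc k) * qint q (2 * k))"
    unfolding M_def qint_mult_diff[OF k(2), symmetric] by (simp add: algebra_simps)
  moreover have "\<dots> \<ge> 0" using assms nn by simp
  ultimately have M_le: "M (Suc k) \<le> M k" by simp
  have M_pos: "M k > 0"
  proof (cases "\<alpha> = 0")
    case True
    then show ?thesis using k pos by (simp add: M_def)
  next
    case False
    then have "\<alpha> * qint q n * qint q (n - 1) > 0" using assms pos by simp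
    moreover have "(1 - \<alpha>) * (qint q (n - k) * qint q (n - 1 + k)) \<ge> 0" using assms nn by simp
    ultimately show ?thesis by (simp add: M_def)
  qed
  have "n - k = Suc (n - Suc k)" using k by simp
  then have "qfact q (n - k) = qint q (n - k) * qfact q (n - Suc k)"
    by (metis qfact_Suc)
  then have "q ^ (Suc k * (Suc k - 1) div 2) * qfact q (n - 2) / (qint q n ^ Suc k * qfact q (n - Suc k)) = Z * \<rho>"
    unfolding Z_def \<rho>_def triangle_Suc using pos[of "n - k"] n0 k
    by (simp add: power_add field_simps)
  then have "eigval q \<alpha> n (Suc k) = Z * (\<rho> * M (Suc k))"
    using eigval_eq_acoef[OF assms(1,4), of "Suc k" \<alpha>] k by (simp add: acoef)
  also have "\<rho> * M (Suc k) \<le> \<rho> * M k"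
    using \<rho> M_le by (intro mult_left_mono)
  also have "\<rho> * M k < M k"
    using \<rho> M_pos by simp
  also have "Z * M k = eigval q \<alpha> n k"
    using eigval_eq_acoef[OF assms(1,4), of k \<alpha>] k by (simp add: acoef Z_def)
  finally show ?thesis
    using Z by simp
qed

lemma eigval_less:
  assumes "q > 0" "0 \<le> \<alpha>" "\<alpha> \<le> 1" "n \<ge> 2" "2 \<le> k" "k \<le> n" "j < k"
  shows "eigval q \<alpha> n k < eigval q \<alpha> n j"
proof -
  have pos: "eigval q \<alpha> n k < eigval q \<alpha> n i" if "1 \<le> i" "i < k" for i
  proof -
    from \<open>i < k\<close> have "Suc i \<le> k" by simp
    then show ?thesis
      using \<open>k \<le> n\<close>
    proof (induction k rule: dec_induct)
      case base
      then show ?case using eigval_Suc_less[OF assms(1-4) that(1)] by simp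
    next
      case (step l)
      then show ?case using eigval_Suc_less[OF assms(1-4), of l] that(1) by simp
    qed
  qed
  show ?thesis
  proof (cases j)
    case 0
    then show ?thesis using pos[of 1] assms(5) by (simp add: eigval_def)
  qed (use pos assms(7) in simp)
qed

section \<open>The eigenvectors\<close>

lemma poly_eq_sum_atMost:
  fixes p :: "'a::comm_semiring_1 poly"
  assumes "degree p \<le> n"
  shows "poly p x = (\<Sum>k\<le>n. coeff p k * x ^ k)"
  unfolding poly_altdef using assms
  by (intro sum.mono_neutral_left) (auto simp: coeff_eq_0)

lemma coeff_bernstein_poly:
  assumes "q > 0" "n \<ge> 2" "degree p \<le> n"
  shows "coeff (bernstein q \<alpha> n (poly p)) r = (\<Sum>k\<in>{r..n}. coeff p k * acoef q \<alpha> n r k)"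
proof -
  have "bernstein q \<alpha> n (poly p) = (\<Sum>k\<le>n. smult (coeff p k) (bernstein q \<alpha> n (\<lambda>t. t ^ k)))"
  proof (rule poly_eqI)
    show "coeff (bernstein q \<alpha> n (poly p)) i
        = coeff (\<Sum>k\<le>n. smult (coeff p k) (bernstein q \<alpha> n (\<lambda>t. t ^ k))) i" for i
      unfolding bernstein_def poly_eq_sum_atMost[OF assms(3)] coeff_sum coeff_smult
        sum_distrib_left sum_distrib_right
      by (subst sum.swap) (simp add: mult_ac)
  qed
  also have "coeff \<dots> r = (\<Sum>k\<le>n. coeff p k * (if r \<le> k then acoef q \<alpha> n r k else 0))"
    unfolding coeff_sum coeff_smult
    by (intro sum.cong refl) (simp add: bernstein_power assms coeff_sum coeff_monom)
  also have "\<dots> = (\<Sum>k\<in>{r..n}. coeff p k * acoef q \<alpha> n r k)"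
    by (intro sum.mono_neutral_cong_right) auto
  finally show ?thesis .
qed

lemma bernstein_diff:
  "bernstein q \<alpha> n (poly (p - r)) = bernstein q \<alpha> n (poly p) - bernstein q \<alpha> n (poly r)"
  by (simp add: bernstein_def smult_diff_left sum_subtractf)

text \<open>
  By triangularity the leading coefficient of the image of \<open>p\<close> is the leading coefficient of \<open>p\<close>
  times the diagonal entry.
\<close>

lemma eigenvalue_eq_eigval_degree:
  assumes "q > 0" "n \<ge> 2" "degree p \<le> n" "p \<noteq> 0"
    and "bernstein q \<alpha> n (poly p) = smult l p"
  shows "l = eigval q \<alpha> n (degree p)"
proof -
  have "l * lead_coeff p = (\<Sum>k\<in>{degree p..n}. coeff p k * acoef q \<alpha> n (degree p) k)"
    using coeff_bernstein_poly[OF assms(1-3), of \<alpha> "degree p"] assms(5) by simp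
  also have "\<dots> = (\<Sum>k\<in>{degree p}. coeff p k * acoef q \<alpha> n (degree p) k)"
    using assms(3) by (intro sum.mono_neutral_right) (auto simp: coeff_eq_0)
  also have "\<dots> = eigval q \<alpha> n (degree p) * lead_coeff p"
    by (simp add: eigval_eq_acoef assms)
  finally show ?thesis
    using assms(4) by simp
qed

lemma poly_eq_if_eq_on_unit_interval:
  fixes p r :: "real poly"
  assumes "\<forall>x\<in>{0..1}. poly p x = poly r x"
  shows "p = r"
proof (rule ccontr)
  assume "p \<noteq> r"
  then have "finite {x. poly (p - r) x = 0}"
    by (intro poly_roots_finite) simp
  then have "finite {0..1::real}"
    by (rule rev_finite_subset) (use assms in auto)
  then show False
    using infinite_Icc[of 0 "1::real"] by simp
qed

text \<open>
  A polynomial is determined by its values on \<open>[0, 1]\<close>, so for polynomial functions the eigenvector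
  equation is an equation between polynomials.
\<close>

lemma bernstein_eigenvector_poly_iff:
  "bernstein_eigenvector q \<alpha> n l (poly p) \<longleftrightarrow> p \<noteq> 0 \<and> bernstein q \<alpha> n (poly p) = smult l p"
  using poly_eq_if_eq_on_unit_interval[of p 0]
    poly_eq_if_eq_on_unit_interval[of "bernstein q \<alpha> n (poly p)" "smult l p"]
  by (auto simp: bernstein_eigenvector_def)

lemma coeff_eigpoly: "coeff (eigpoly q \<alpha> n k) j = ccoef q \<alpha> n j k"
  by (simp add: eigpoly_def coeff_sum coeff_monom ccoef.simps[of q \<alpha> n j k])

lemma ccoef_self [simp]: "ccoef q \<alpha> n k k = 1"
  and ccoef_eq_0: "k < r \<Longrightarrow> ccoef q \<alpha> n r k = 0"
  by (simp_all add: ccoef.simps)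

lemma degree_eigpoly: "degree (eigpoly q \<alpha> n k) = k"
  by (rule antisym[OF degree_le le_degree]) (simp_all add: coeff_eigpoly ccoef_eq_0)

text \<open>
  In row \<open>r < k\<close> the diagonal term of the triangular system contributes \<open>\<lambda>\<^sub>r c(r, k)\<close>; the rest of
  the row is the sum in the recursion for \<open>c(r, k)\<close>, hence equals \<open>(\<lambda>\<^sub>k - \<lambda>\<^sub>r) c(r, k)\<close>.
\<close>

lemma bernstein_eigpoly:
  assumes "q > 0" "0 \<le> \<alpha>" "\<alpha> \<le> 1" "n \<ge> 2" "k \<le> n"
  shows "bernstein q \<alpha> n (poly (eigpoly q \<alpha> n k)) = smult (eigval q \<alpha> n k) (eigpoly q \<alpha> n k)"
proof (rule poly_eqI)
  fix r
  let ?c = "\<lambda>j. ccoef q \<alpha> n j k"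
  let ?l = "eigval q \<alpha> n"
  have coeff: "coeff (bernstein q \<alpha> n (poly (eigpoly q \<alpha> n k))) r = (\<Sum>i\<in>{r..k}. ?c i * acoef q \<alpha> n r i)"
    using assms(5)
    unfolding coeff_bernstein_poly[OF assms(1,4), of "eigpoly q \<alpha> n k", unfolded degree_eigpoly, OF assms(5)]
    by (intro sum.mono_neutral_cong_right) (auto simp: coeff_eigpoly ccoef_eq_0)
  have "(\<Sum>i\<in>{r..k}. ?c i * acoef q \<alpha> n r i) = ?l k * ?c r"
  proof (cases "r < k")
    case False
    then show ?thesis
      using eigval_eq_acoef[OF assms(1,4,5), of \<alpha>] by (cases "r = k") (auto simp: ccoef_eq_0)
  next
    case True
    have "(\<Sum>i\<in>{Suc r..k}. ?c i * acoef q \<alpha> n r i) = (\<Sum>i<k - r. ?c (k - i) * acoef q \<alpha> n r (k - i))"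
      by (rule sum.reindex_bij_witness[of _ "\<lambda>i. k - i" "\<lambda>i. k - i"]) auto
    also have "\<dots> = (?l k - ?l r) * ?c r"
    proof (cases "k \<le> 1")
      case True
      with \<open>r < k\<close> have "r = 0" "k = 1" by auto
      moreover have "acoef q \<alpha> n 0 1 = 0"
        using qstirling_Suc_Suc[OF assms(1), of "Suc 0" 0] by (simp add: acoef_def)
      ultimately show ?thesis by (simp add: eigval_def)
    next
      case False
      then have "?l k \<noteq> ?l r"
        using eigval_less[OF assms(1-4) _ assms(5) True] by simp
      then show ?thesis
        using True False by (simp add: ccoef.simps[of q \<alpha> n r k])
    qed
    finally have "(\<Sum>i\<in>{Suc r..k}. ?c i * acoef q \<alpha> n r i) = (?l k - ?l r) * ?c r" .
    then show ?thesis
      using True assms eigval_eq_acoef[OF assms(1,4), of r \<alpha>]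
      by (subst sum.atLeast_Suc_atMost) (auto simp: algebra_simps)
  qed
  then show "coeff (bernstein q \<alpha> n (poly (eigpoly q \<alpha> n k))) r = coeff (smult (?l k) (eigpoly q \<alpha> n k)) r"
    by (simp add: coeff coeff_eigpoly)
qed

text \<open>
  An eigenvector for \<open>\<lambda>\<^sub>k\<close> has degree \<open>k\<close>, since no other diagonal entry equals \<open>\<lambda>\<^sub>k\<close>. The difference
  of two monic ones has lower degree and must therefore vanish.
\<close>

lemma eigpoly_unique:
  assumes "q > 0" "0 \<le> \<alpha>" "\<alpha> \<le> 1" "n \<ge> 2" "2 \<le> k" "k \<le> n"
    and p: "degree p \<le> n" "lead_coeff p = 1" "bernstein q \<alpha> n (poly p) = smult (eigval q \<alpha> n k) p"
  shows "p = eigpoly q \<alpha> n k"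
proof (rule ccontr)
  have deg: "degree r = k"
    if "degree r \<le> n" "r \<noteq> 0" "bernstein q \<alpha> n (poly r) = smult (eigval q \<alpha> n k) r" for r
  proof (rule ccontr)
    assume "degree r \<noteq> k"
    then consider "degree r < k" | "k < degree r" by linarith
    then show False
      using eigenvalue_eq_eigval_degree[OF assms(1,4) that]
        eigval_less[OF assms(1-6), of "degree r"] eigval_less[OF assms(1-4) _ that(1), of k] assms(5)
      by cases auto
  qed
  let ?d = "p - eigpoly q \<alpha> n k"
  assume "p \<noteq> eigpoly q \<alpha> n k"
  then have nz: "?d \<noteq> 0" by simp
  have "p \<noteq> 0"
    using p(2) by auto
  then have "degree p = k"
    using deg[of p] p by simp
  then have "degree ?d \<le> k"
    using degree_diff_le[of p k "eigpoly q \<alpha> n k"] by (simp add: degree_eigpoly)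
  moreover have "bernstein q \<alpha> n (poly ?d) = smult (eigval q \<alpha> n k) ?d"
    unfolding bernstein_diff p(3) bernstein_eigpoly[OF assms(1-4,6)] by (simp add: smult_diff_right)
  ultimately have "degree ?d = k"
    using deg[OF _ nz] assms(6) by simp
  moreover have "coeff ?d k = 0"
    using p(2) \<open>degree p = k\<close> by (simp add: coeff_eigpoly)
  ultimately show False
    using nz leading_coeff_neq_0[of ?d] by simp
qed

theorem theorem4p2:
  fixes q \<alpha> :: real and n :: nat
  assumes "q > 0" and "0 \<le> \<alpha>" and "\<alpha> \<le> 1" and "n \<ge> 2"
  shows "(\<forall>k\<le>n. degree (eigpoly q \<alpha> n k) = k \<and> lead_coeff (eigpoly q \<alpha> n k) = 1 \<and>
            bernstein_eigenvector q \<alpha> n (eigval q \<alpha> n k) (poly (eigpoly q \<alpha> n k))) \<and>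
         (\<forall>k\<in>{2..n}. \<forall>p. degree p \<le> n \<and> lead_coeff p = 1 \<and>
            bernstein_eigenvector q \<alpha> n (eigval q \<alpha> n k) (poly p) \<longrightarrow> p = eigpoly q \<alpha> n k) \<and>
         eigpoly q \<alpha> n 0 = 1 \<and>
         eigpoly q \<alpha> n 1 = [:0, 1:] \<and>
         (\<forall>k\<in>{2..n}. ccoef q \<alpha> n k k = 1 \<and>
            (\<forall>j\<in>{1..k}. eigval q \<alpha> n k - eigval q \<alpha> n (k - j) \<noteq> 0 \<and>
               ccoef q \<alpha> n (k - j) k =
                 1 / (eigval q \<alpha> n k - eigval q \<alpha> n (k - j))
                 * (\<Sum>i=0..j - 1. ccoef q \<alpha> n (k - i) k * acoef q \<alpha> n (k - j) (k - i))))"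
proof (intro conjI ballI allI impI)
  fix k assume k: "k \<le> n"
  show "degree (eigpoly q \<alpha> n k) = k" and "lead_coeff (eigpoly q \<alpha> n k) = 1"
    by (simp_all add: degree_eigpoly coeff_eigpoly)
  then have "eigpoly q \<alpha> n k \<noteq> 0" by auto
  then show "bernstein_eigenvector q \<alpha> n (eigval q \<alpha> n k) (poly (eigpoly q \<alpha> n k))"
    by (simp add: bernstein_eigenvector_poly_iff bernstein_eigpoly[OF assms k])
next
  fix k p assume "k \<in> {2..n}"
    and "degree p \<le> n \<and> lead_coeff p = 1 \<and> bernstein_eigenvector q \<alpha> n (eigval q \<alpha> n k) (poly p)"
  then show "p = eigpoly q \<alpha> n k"
    by (intro eigpoly_unique[OF assms]) (auto simp: bernstein_eigenvector_poly_iff)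
next
  show "eigpoly q \<alpha> n 0 = 1"
    by (simp add: eigpoly_def monom_0)
  show "eigpoly q \<alpha> n 1 = [:0, 1:]"
    by (simp add: eigpoly_def ccoef.simps[of q \<alpha> n 0] monom_Suc monom_0)
next
  fix k assume "k \<in> {2..n}"
  then have k: "2 \<le> k" "k \<le> n" by auto
  show "ccoef q \<alpha> n k k = 1" by simp
  fix j assume "j \<in> {1..k}"
  then have j: "1 \<le> j" "j \<le> k" by auto
  then show "eigval q \<alpha> n k - eigval q \<alpha> n (k - j) \<noteq> 0"
    using eigval_less[OF assms k, of "k - j"] by simp
  have "{0..j - 1} = {..<k - (k - j)}"
    using j by auto
  moreover have "\<not> k - j > k" "k - j \<noteq> k" "\<not> k \<le> 1"
    using j k by auto
  ultimately show "ccoef q \<alpha> n (k - j) k =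
      1 / (eigval q \<alpha> n k - eigval q \<alpha> n (k - j))
      * (\<Sum>i=0..j - 1. ccoef q \<alpha> n (k - i) k * acoef q \<alpha> n (k - j) (k - i))"
    by (simp only: ccoef.simps[of q \<alpha> n "k - j" k] if_False)
qed

end
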